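(* Let $\mathbf P=(P,\leq,{}',0,1)$ be an orthogonal mlb-complete poset, and for $x,y\in P$ let $x\rightarrow y:=y\vee\operatorname{Max}L(x',y')=\{y\vee w\mid w\in\operatorname{Max}L(x',y')\}$. Then the following are equivalent: (i) $\mathbf P$ is paraorthomodular. (ii) For all $x,y\in P$, if $x\rightarrow y=1$ then $x\leq y$.
   Context: For a poset $(P,\leq)$, $L(a,b)$ is the set of common lower bounds of $a$ and $b$, and $\operatorname{Max}A$ is the set of maximal elements of $A$. Elements are identified with singletons, so $x\rightarrow y=1$ means $x\rightarrow y=\{1\}$. An antitone involution on $P$ is a unary operation ${}'$ with $x''=x$ such that $x\leq y$ implies $y'\leq x'$. Write $x\perp y$ if $x\leq y'$. An orthogonal poset is a bounded poset $(P,\leq,{}',0,1)$ with an antitone involution such that $x\perp y$ implies that the supremum $x\vee y$ exists (hence all suprema in the definition of $\rightarrow$ exist). A bounded poset with antitone involution is paraorthomodular if $x\leq y$ and $x'\wedge y=0$ (i.e. $L(x',y)=\{0\}$) together imply $x=y$. A poset is mlb-complete if for every finite subset $M$ and every lower bound $x$ of $M$ there is a maximal lower bound of $M$ above (or equal to) $x$. *)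

theory Defs
  imports "HOL-Library.Lub_Glb"
begin

text \<open>
  A bounded poset is a type of sort \<open>{order_bot, order_top}\<close>; its bounds 0 and 1 are
  \<open>bot\<close> and \<open>top\<close>, and \<open>bot = top\<close> is not excluded. The unary operation is passed as an
  explicit argument \<open>c\<close>.
\<close>

definition antitone_involution :: "('a::order \<Rightarrow> 'a) \<Rightarrow> bool" where
  "antitone_involution c \<longleftrightarrow> (\<forall>x. c (c x) = x) \<and> antimono c"

definition orthogonal :: "('a::order \<Rightarrow> 'a) \<Rightarrow> 'a \<Rightarrow> 'a \<Rightarrow> bool" where
  "orthogonal c x y \<longleftrightarrow> x \<le> c y"

definition orthogonal_poset :: "('a::{order_bot,order_top} \<Rightarrow> 'a) \<Rightarrow> bool" where
  "orthogonal_poset c \<longleftrightarrow> antitone_involution c \<and>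
     (\<forall>x y. orthogonal c x y \<longrightarrow> (\<exists>s. isLub UNIV {x, y} s))"

abbreviation lower_bounds :: "'a::order set \<Rightarrow> 'a set" where
  "lower_bounds M \<equiv> lbs UNIV M"

definition paraorthomodular :: "('a::{order_bot,order_top} \<Rightarrow> 'a) \<Rightarrow> bool" where
  "paraorthomodular c \<longleftrightarrow> antitone_involution c \<and>
     (\<forall>x y. x \<le> y \<and> lower_bounds {c x, y} = {bot} \<longrightarrow> x = y)"

definition maximal_elements :: "'a::order set \<Rightarrow> 'a set" where
  "maximal_elements A = {m \<in> A. \<not> (\<exists>a\<in>A. m < a)}"

definition mlb_complete :: "'a::order itself \<Rightarrow> bool" where
  "mlb_complete T \<longleftrightarrow>
     (\<forall>(M :: 'a set) x. finite M \<and> x \<in> lower_bounds M \<longrightarrow>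
        (\<exists>m \<in> maximal_elements (lower_bounds M). x \<le> m))"

text \<open>
  The supremum is a partial operation: \<open>poset_join x y\<close> is meaningful only if \<open>{x, y}\<close> has a
  least upper bound. In an orthogonal poset this is the case for every join in \<open>poset_imp\<close>,
  since \<open>w \<le> c y\<close> for each \<open>w\<close> in \<open>lower_bounds {c x, c y}\<close>.
\<close>

definition poset_join :: "'a::order \<Rightarrow> 'a \<Rightarrow> 'a" where
  "poset_join x y = (THE s. isLub UNIV {x, y} s)"

definition poset_imp :: "('a::order \<Rightarrow> 'a) \<Rightarrow> 'a \<Rightarrow> 'a \<Rightarrow> 'a set" where
  "poset_imp c x y = {poset_join y w | w. w \<in> maximal_elements (lower_bounds {c x, c y})}"

end

theory Submission
  imports Defs
begin

text \<open>The involution turns "x \<or> y = 1" into "0 is the only common lower bound of x' and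
  y'" (\<open>isLub_top_iff_lower_bounds\<close>), so paraorthomodularity says: if a \<le> b and a
  \<or> b' = 1, then a = b. If x \<rightarrow> y = 1, some w in Max L(x', y') has y \<or> w = 1;
  since w \<le> y', paraorthomodularity gives w = y', hence y' \<le> x' and x \<le> y. Conversely,
  if x \<le> y, then y' \<le> x', so Max L(y', x') = {y'} and y \<rightarrow> x is the single
  element x \<or> y'. When this is 1, (ii) yields y \<le> x.\<close>

lemma mem_lower_bounds_pair: "z \<in> lower_bounds {x, y} \<longleftrightarrow> z \<le> x \<and> z \<le> (y::'a::order)"
  by (auto simp: lbs_def isLb_def setge_def)

lemma isLub_UNIV_pair_iff:
  "isLub UNIV {x, y} s \<longleftrightarrow> x \<le> s \<and> y \<le> s \<and> (\<forall>u. x \<le> u \<and> y \<le> u \<longrightarrow> s \<le> (u::'a::order))"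
  by (auto simp: isLub_def leastP_def isUb_def setle_def setge_def)

lemma poset_join_eqI: "isLub UNIV {x, y} s \<Longrightarrow> poset_join x y = (s::'a::order)"
  unfolding poset_join_def isLub_UNIV_pair_iff by (rule the_equality) (auto intro: order.antisym)

lemma antitone_involution_le_iff:
  assumes "antitone_involution c"
  shows "c x \<le> c y \<longleftrightarrow> y \<le> x"
  using assms unfolding antitone_involution_def by (metis antimonoD)

lemma antitone_involution_top:
  fixes c :: "'a::{order_bot,order_top} \<Rightarrow> 'a"
  assumes "antitone_involution c"
  shows "c top = bot"
  using antitone_involution_le_iff[OF assms, of top "c bot"] assms
  by (simp add: antitone_involution_def bot_unique)

text \<open>De Morgan duality: \<open>c\<close> exchanges the upper bounds of x, y with the lower
  bounds of their images, and \<open>top\<close> with \<open>bot\<close>. Using \<open>isLub\<close>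
  instead of \<open>poset_join\<close> builds the existence of the supremum into the
  statement.\<close>

lemma isLub_top_iff_lower_bounds:
  fixes c :: "'a::{order_bot,order_top} \<Rightarrow> 'a"
  assumes c: "antitone_involution c"
  shows "isLub UNIV {x, y} top \<longleftrightarrow> lower_bounds {c x, c y} = {bot}"
proof -
  have inv: "c (c u) = u" for u
    using c by (simp add: antitone_involution_def)
  have "isLub UNIV {x, y} top \<longleftrightarrow> (\<forall>u. x \<le> u \<and> y \<le> u \<longrightarrow> u = top)"
    by (simp add: isLub_UNIV_pair_iff top_unique)
  also have "\<dots> \<longleftrightarrow> (\<forall>z. z \<le> c x \<and> z \<le> c y \<longrightarrow> z = bot)"
    by (metis antitone_involution_le_iff[OF c] antitone_involution_top[OF c] inv)
  also have "\<dots> \<longleftrightarrow> lower_bounds {c x, c y} = {bot}"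
    by (auto simp: set_eq_iff mem_lower_bounds_pair)
  finally show ?thesis .
qed

text \<open>An equation about \<open>poset_join\<close>, a definite description, carries information
  only once the supremum is known to exist; orthogonality supplies this.\<close>

lemma orthogonal_poset_isLub_join:
  fixes c :: "'a::{order_bot,order_top} \<Rightarrow> 'a"
  assumes "orthogonal_poset c" and "x \<le> c y"
  shows "isLub UNIV {x, y} (poset_join x y)"
  using assms poset_join_eqI unfolding orthogonal_poset_def orthogonal_def by metis

theorem theorem3p4:
  fixes c :: "'a::{order_bot,order_top} \<Rightarrow> 'a"
  assumes "orthogonal_poset c"
    and "mlb_complete TYPE('a)"
  shows "paraorthomodular c \<longleftrightarrow> (\<forall>x y. poset_imp c x y = {top} \<longrightarrow> x \<le> y)"
proof -
  have c: "antitone_involution c"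
    using assms(1) by (simp add: orthogonal_poset_def)
  have inv: "c (c u) = u" for u
    using c by (simp add: antitone_involution_def)
  note le_iff = antitone_involution_le_iff[OF c]
  show ?thesis
  proof (intro iffI allI impI)
    fix x y
    assume P: "paraorthomodular c" and imp: "poset_imp c x y = {top}"
    from imp have "top \<in> poset_imp c x y" by simp
    then obtain w where "w \<in> maximal_elements (lower_bounds {c x, c y})"
      and top: "poset_join y w = top"
      unfolding poset_imp_def by auto
    then have wx: "w \<le> c x" and wy: "w \<le> c y"
      by (simp_all add: maximal_elements_def mem_lower_bounds_pair)
    \<comment> \<open>Orthogonality is symmetric; this orientation fits the join
      \<open>poset_join y w\<close>.\<close>
    have "y \<le> c w" using wy le_iff inv by metis
    then have "isLub UNIV {y, w} top"
      using orthogonal_poset_isLub_join[OF assms(1)] top by metis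
    then have "lower_bounds {c w, c y} = {bot}"
      by (simp add: isLub_top_iff_lower_bounds[OF c] insert_commute)
    \<comment> \<open>Paraorthomodularity for the pair \<open>w\<close>, \<open>c y\<close>.\<close>
    with P wy have "w = c y" unfolding paraorthomodular_def by blast
    with wx show "x \<le> y" by (simp add: le_iff)
  next
    assume imp: "\<forall>x y. poset_imp c x y = {top} \<longrightarrow> x \<le> y"
    have "x = y" if le: "x \<le> y" and bot: "lower_bounds {c x, y} = {bot}" for x y
    proof -
      have "isLub UNIV {x, c y} top"
        using bot by (simp add: isLub_top_iff_lower_bounds[OF c] inv)
      then have join: "poset_join x (c y) = top" by (rule poset_join_eqI)
      have "c y \<le> c x" using le by (simp add: le_iff)
      \<comment> \<open>\<open>c y\<close> is itself a common lower bound, hence the greatest one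
        and the only maximal one.\<close>
      then have "maximal_elements (lower_bounds {c y, c x}) = {c y}"
        by (force simp: maximal_elements_def mem_lower_bounds_pair order.strict_iff_order)
      then have "poset_imp c y x = {top}"
        by (simp add: poset_imp_def join)
      with imp le show "x = y" by (meson order.antisym)
    qed
    with c show "paraorthomodular c" unfolding paraorthomodular_def by blast
  qed
qed

end
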